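(* Let $S \subset \mathbb{F}_2^n$, let $\delta \in (0, 1/10]$ and $\tau > 1$ be such that $$|S| > \max\left(\frac{n^4(1+\tau)^4}{((\tau - \sqrt{\tau})\delta)^8},\, n^4\right)$$ and $$n \geq 20\left\lceil \log_2\left(\max\left(\frac{n(1+\tau)}{((\tau-\sqrt{\tau})\delta)^2},\, n\right)\right)\right\rceil.$$ Then there exists a natural number $$t \geq \log_2|S| - 4\log_2\left(\max\left(\frac{n(1+\tau)}{(\tau - \sqrt{\tau})^2\delta^2},\, n\right)\right)$$ such that at least a $(1-\delta)$-fraction of all surjective linear maps $L : \mathbb{F}_2^n \to \mathbb{F}_2^t$ have the property that $L(U_S)$ is $\tau 2^{-t}$-close to uniform in the $\ell_\infty$ norm, i.e. $|\Pr[L(U_S)=y] - 2^{-t}| \leq \tau 2^{-t}$ for all $y \in \mathbb{F}_2^t$.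
   Context: $U_S$ denotes a random variable distributed uniformly on the finite set $S$. A random variable $X$ on a finite set $Y$ is $\epsilon$-close to uniform in the $\ell_\infty$ norm if $|\Pr[X=y] - 1/|Y|| \leq \epsilon$ for every $y \in Y$. *)

theory Defs
  imports Complex_Main
begin

text \<open>The vector space F_2^n is modelled as bool lists of length n
  (True = 1, False = 0, addition = xor).\<close>

definition F2vecs :: "nat \<Rightarrow> bool list set" where
  "F2vecs n = {xs. length xs = n}"

definition F2dot :: "bool list \<Rightarrow> bool list \<Rightarrow> bool" where
  "F2dot r x = odd (length (filter id (map2 (\<and>) r x)))"

text \<open>Linear maps F_2^n -> F_2^t are exactly the t x n matrices over F_2
  (a list of t rows, each of length n), acting by matrix-vector product.\<close>
definition F2mats :: "nat \<Rightarrow> nat \<Rightarrow> bool list list set" where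
  "F2mats t n = {A. length A = t \<and> (\<forall>r\<in>set A. length r = n)}"

definition F2apply :: "bool list list \<Rightarrow> bool list \<Rightarrow> bool list" where
  "F2apply A x = map (\<lambda>r. F2dot r x) A"

definition F2surj_maps :: "nat \<Rightarrow> nat \<Rightarrow> bool list list set" where
  "F2surj_maps n t = {A \<in> F2mats t n. F2apply A ` F2vecs n = F2vecs t}"

definition prob_image :: "bool list list \<Rightarrow> bool list set \<Rightarrow> bool list \<Rightarrow> real" where
  "prob_image A S y = real (card {x \<in> S. F2apply A x = y}) / real (card S)"

definition linf_close_uniform :: "nat \<Rightarrow> real \<Rightarrow> bool list list \<Rightarrow> bool list set \<Rightarrow> bool" where
  "linf_close_uniform t eps A S =
     (\<forall>y \<in> F2vecs t. \<bar>prob_image A S y - 1 / 2 ^ t\<bar> \<le> eps)"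

end

theory Submission
  imports Defs
begin

text \<open>As \<open>\<tau> > 1\<close>, only upper bounds on the bucket sizes matter.  Let \<open>\<mu> = |S| / 2^t\<close>
  be the mean bucket size of a random \<open>L\<close>, and refine \<open>L\<close> by \<open>d\<close> further random rows, where
  \<open>D = 2^d\<close> is about \<open>n\<close>.  If a bucket of \<open>L\<close> has more than \<open>(1 + \<tau>) \<mu>\<close> elements, then by
  pairwise independence the refinement splits it, with probability at least one half, into \<open>D\<close> cells
  that are all heavy, i.e. of size at least \<open>(1 + sqrt \<tau>) \<mu> / D\<close>.  By Chebyshev the heavy cells have
  expected density at most \<open>D / (\<tau> \<mu>)\<close> in \<open>F_2^(t+d)\<close>.  The distribution of the refined map is
  invariant under shears of \<open>F_2^(t+d)\<close>, and a random shear squares the density of the pairs of cells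
  that are both heavy.  Iterating \<open>d\<close> times, a coset consisting of heavy cells only exists with
  probability at most \<open>2^(t/D)\<close> times the density, and \<open>2^(t/D) \<le> 2\<close>.\<close>

section \<open>Vectors, matrices and linear maps over F_2\<close>

definition F2add :: "bool list \<Rightarrow> bool list \<Rightarrow> bool list" where
  "F2add x y = map2 (\<noteq>) x y"

lemma F2add_simps [simp]:
  "F2add [] [] = []"
  "F2add (a # x) (b # y) = (a \<noteq> b) # F2add x y"
  "length (F2add x y) = min (length x) (length y)"
  by (simp_all add: F2add_def)

text \<open>With \<open>B = S\<close> this is a bucket or a cell; with \<open>B = F2vecs n\<close>
  it is the solution set of \<open>A x = y\<close>; with \<open>B\<close> a bucket of
  \<open>L\<close> it is one of the cells into which a further matrix splits that bucket.\<close>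

definition fiber :: "bool list list \<Rightarrow> bool list set \<Rightarrow> bool list \<Rightarrow> bool list set" where
  "fiber A B y = {x \<in> B. F2apply A x = y}"

lemma F2vecs_0: "F2vecs 0 = {[]}"
  by (auto simp: F2vecs_def)

lemma F2mats_0: "F2mats 0 n = {[]}"
  by (auto simp: F2mats_def)

lemma F2vecs_Suc: "F2vecs (Suc n) = (\<lambda>(b, x). b # x) ` (UNIV \<times> F2vecs n)"
  by (auto simp: F2vecs_def length_Suc_conv image_iff)

lemma ball_F2vecs_Suc:
  "(\<forall>y\<in>F2vecs (Suc n). P y) \<longleftrightarrow> (\<forall>y\<in>F2vecs n. P (False # y) \<and> P (True # y))"
  by (auto simp: F2vecs_Suc UNIV_bool)

lemma F2mats_Suc: "F2mats (Suc t) n = (\<lambda>(r, A). r # A) ` (F2vecs n \<times> F2mats t n)"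
  by (auto simp: F2mats_def F2vecs_def length_Suc_conv image_iff)

lemma finite_F2vecs [simp]: "finite (F2vecs n)"
  by (induction n) (auto simp: F2vecs_0 F2vecs_Suc)

lemma finite_F2mats [simp]: "finite (F2mats t n)"
  by (induction t) (auto simp: F2mats_0 F2mats_Suc)

lemma card_F2vecs [simp]: "card (F2vecs n) = 2 ^ n"
proof (induction n)
  case (Suc n)
  have "inj_on (\<lambda>(b, x). b # x) (UNIV \<times> F2vecs n)" by (auto simp: inj_on_def)
  then show ?case using Suc by (simp add: F2vecs_Suc card_image card_cartesian_product)
qed (simp add: F2vecs_0)

lemma sum_F2mats_Suc:
  "(\<Sum>A\<in>F2mats (Suc t) n. f A) = (\<Sum>r\<in>F2vecs n. \<Sum>A\<in>F2mats t n. f (r # A))"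
proof -
  have "inj_on (\<lambda>(r, A). r # A) (F2vecs n \<times> F2mats t n)" by (auto simp: inj_on_def)
  then show ?thesis
    by (simp add: F2mats_Suc sum.reindex sum.cartesian_product case_prod_unfold)
qed

lemma card_F2mats: "card (F2mats t n) = (2 ^ n) ^ t"
proof (induction t)
  case (Suc t)
  have "inj_on (\<lambda>(r, A). r # A) (F2vecs n \<times> F2mats t n)" by (auto simp: inj_on_def)
  then show ?case using Suc by (simp add: F2mats_Suc card_image card_cartesian_product)
qed (simp add: F2mats_0)

lemma card_F2mats_pos: "card (F2mats t n) > 0"
  by (simp add: card_F2mats)

lemma F2add_in_F2vecs: "x \<in> F2vecs n \<Longrightarrow> y \<in> F2vecs n \<Longrightarrow> F2add x y \<in> F2vecs n"
  by (simp add: F2vecs_def)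

lemma F2add_cancel_right: "length x = length y \<Longrightarrow> F2add (F2add x y) y = x"
  by (induction x y rule: list_induct2) auto

lemma F2add_cancel_left: "length x = length y \<Longrightarrow> F2add x (F2add x y) = y"
  by (induction x y rule: list_induct2) auto

lemma F2add_eq_iff:
  assumes "length x = length y" "length z = length y"
  shows "F2add x y = z \<longleftrightarrow> x = F2add z y"
  using F2add_cancel_right[OF assms(1)] F2add_cancel_right[OF assms(2)] by auto

lemma bij_betw_F2add: "x \<in> F2vecs n \<Longrightarrow> bij_betw (F2add x) (F2vecs n) (F2vecs n)"
  by (rule bij_betw_byWitness[where f' = "F2add x"])
     (auto simp: F2vecs_def F2add_cancel_left)

lemma F2dot_Nil: "F2dot [] x = False" "F2dot r [] = False"
  by (simp_all add: F2dot_def)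

lemma F2dot_Cons: "F2dot (a # r) (b # x) = ((a \<and> b) \<noteq> F2dot r x)"
  by (auto simp: F2dot_def)

lemma F2dot_add_left:
  "length r = length s \<Longrightarrow> length s = length x \<Longrightarrow>
    F2dot (F2add r s) x = (F2dot r x \<noteq> F2dot s x)"
  by (induction r s x rule: list_induct3) (auto simp: F2dot_Nil F2dot_Cons)

lemma F2dot_add_right:
  "length r = length x \<Longrightarrow> length x = length y \<Longrightarrow>
    F2dot r (F2add x y) = (F2dot r x \<noteq> F2dot r y)"
  by (induction r x y rule: list_induct3) (auto simp: F2dot_Nil F2dot_Cons)

lemma F2apply_Cons: "F2apply (r # A) x = F2dot r x # F2apply A x"
  by (simp add: F2apply_def)

lemma F2apply_append: "F2apply (R @ L) x = F2apply R x @ F2apply L x"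
  by (simp add: F2apply_def)

lemma F2apply_in_F2vecs: "A \<in> F2mats t n \<Longrightarrow> F2apply A x \<in> F2vecs t"
  by (simp add: F2apply_def F2mats_def F2vecs_def)

lemma F2apply_add:
  assumes "A \<in> F2mats t n" "x \<in> F2vecs n" "y \<in> F2vecs n"
  shows "F2apply A (F2add x y) = F2add (F2apply A x) (F2apply A y)"
proof -
  have "\<forall>r\<in>set A. length r = length x" "length x = length y"
    using assms by (auto simp: F2mats_def F2vecs_def)
  then show ?thesis
    by (induction A) (auto simp: F2apply_def F2dot_add_right)
qed

subsection \<open>Pairwise collisions and the second moment\<close>

text \<open>Where the heads of \<open>x\<close> and \<open>y\<close> agree, the first entry of
  \<open>r\<close> is free and the tails decide; where they differ, each tail of \<open>r\<close>
  has exactly one first entry that makes the dot products equal.\<close>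

lemma F2dot_collision:
  "x \<in> F2vecs n \<Longrightarrow> y \<in> F2vecs n \<Longrightarrow> x \<noteq> y \<Longrightarrow>
    2 * card {r \<in> F2vecs n. F2dot r x = F2dot r y} = 2 ^ n"
proof (induction n arbitrary: x y)
  case 0
  then show ?case by (simp add: F2vecs_0)
next
  case (Suc n)
  obtain a x' b y' where xy: "x = a # x'" "y = b # y'" and
    xy': "x' \<in> F2vecs n" "y' \<in> F2vecs n"
    using Suc.prems by (auto simp: F2vecs_Suc)
  define P where "P = (\<lambda>r. F2dot r x' = F2dot r y')"
  have split: "{r \<in> F2vecs (Suc n). F2dot r x = F2dot r y} =
      Cons False ` {r \<in> F2vecs n. P r} \<union>
      Cons True ` {r \<in> F2vecs n. if a = b then P r else \<not> P r}"
    by (auto simp: F2vecs_Suc xy F2dot_Cons P_def image_iff split: if_splits)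
  have "card {r \<in> F2vecs (Suc n). F2dot r x = F2dot r y} =
      card {r \<in> F2vecs n. P r} + card {r \<in> F2vecs n. if a = b then P r else \<not> P r}"
    unfolding split by (subst card_Un_disjoint) (auto simp: card_image)
  moreover have "card {r \<in> F2vecs n. P r} + card {r \<in> F2vecs n. \<not> P r} = 2 ^ n"
  proof -
    have "card {r \<in> F2vecs n. P r} + card {r \<in> F2vecs n. \<not> P r} =
        card ({r \<in> F2vecs n. P r} \<union> {r \<in> F2vecs n. \<not> P r})"
      by (subst card_Un_disjoint) auto
    also have "{r \<in> F2vecs n. P r} \<union> {r \<in> F2vecs n. \<not> P r} = F2vecs n" by auto
    finally show ?thesis by simp
  qed
  \<comment> \<open>The induction hypothesis is confined to equal heads: otherwise the tails may
    coincide.\<close>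
  moreover have "2 * card {r \<in> F2vecs n. P r} = 2 ^ n" if "a = b"
    using Suc.IH[OF xy'] Suc.prems(3) that xy by (simp add: P_def)
  ultimately show ?case by (cases "a = b") auto
qed

text \<open>The \<open>t\<close> rows are chosen independently, and each agrees on \<open>x\<close>
  and \<open>y\<close> with probability one half.\<close>

lemma F2apply_collision:
  assumes "x \<in> F2vecs n" "y \<in> F2vecs n" "x \<noteq> y"
  shows "2 ^ t * card {A \<in> F2mats t n. F2apply A x = F2apply A y} = card (F2mats t n)"
proof (induction t)
  case 0
  have "{A \<in> F2mats 0 n. F2apply A x = F2apply A y} = {[]}"
    by (auto simp: F2mats_0 F2apply_def)
  then show ?case by (simp add: F2mats_0)
next
  case (Suc t)
  let ?E = "{r \<in> F2vecs n. F2dot r x = F2dot r y}"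
  let ?M = "{A \<in> F2mats t n. F2apply A x = F2apply A y}"
  have "{A \<in> F2mats (Suc t) n. F2apply A x = F2apply A y} = (\<lambda>(r, A). r # A) ` (?E \<times> ?M)"
    by (auto simp: F2mats_Suc F2apply_Cons)
  moreover have "inj_on (\<lambda>(r, A). r # A) (?E \<times> ?M)" by (auto simp: inj_on_def)
  ultimately have "card {A \<in> F2mats (Suc t) n. F2apply A x = F2apply A y} = card ?E * card ?M"
    by (simp add: card_image card_cartesian_product)
  then have "2 ^ Suc t * card {A \<in> F2mats (Suc t) n. F2apply A x = F2apply A y} =
      (2 * card ?E) * (2 ^ t * card ?M)" by simp
  also have "\<dots> = card (F2mats (Suc t) n)"
    using Suc F2dot_collision[OF assms] by (simp add: card_F2mats)
  finally show ?case .
qed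

lemma card_eq_sum_indicator: "finite B \<Longrightarrow> real (card {x \<in> B. P x}) = (\<Sum>x\<in>B. if P x then 1 else 0)"
  by (simp add: sum.If_cases Int_def)

text \<open>The squared bucket sizes add up to the number of ordered colliding pairs. Distinct pairs
  collide with probability \<open>2^(-t)\<close>, which the mean terms cancel; the diagonal leaves
  \<open>card B\<close> per matrix. The bound serves for light cells, heavy cells and non-surjective
  maps.\<close>

lemma second_moment:
  assumes B: "B \<subseteq> F2vecs n"
  shows "(\<Sum>A\<in>F2mats t n. \<Sum>y\<in>F2vecs t. (real (card (fiber A B y)) - real (card B) / 2 ^ t)\<^sup>2)
    \<le> real (card (F2mats t n)) * real (card B)"
proof -
  let ?N = "real (card (F2mats t n))" and ?b = "real (card B)"
  have fB: "finite B" using B finite_F2vecs finite_subset by blast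
  have lin: "(\<Sum>y\<in>F2vecs t. real (card (fiber A B y))) = ?b"
    if A: "A \<in> F2mats t n" for A
  proof -
    have "(\<Sum>y\<in>F2vecs t. real (card (fiber A B y))) =
        (\<Sum>y\<in>F2vecs t. \<Sum>x\<in>B. if F2apply A x = y then 1 else 0)"
      by (simp add: fiber_def card_eq_sum_indicator[OF fB])
    also have "\<dots> = (\<Sum>x\<in>B. \<Sum>y\<in>F2vecs t. if F2apply A x = y then 1 else 0)"
      by (rule sum.swap)
    also have "\<dots> = ?b" using F2apply_in_F2vecs[OF A] by simp
    finally show ?thesis .
  qed
  have sq: "(\<Sum>y\<in>F2vecs t. (real (card (fiber A B y)))\<^sup>2) =
      (\<Sum>x\<in>B. \<Sum>x'\<in>B. if F2apply A x = F2apply A x' then 1 else 0)"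
    if A: "A \<in> F2mats t n" for A
  proof -
    have "(\<Sum>y\<in>F2vecs t. (real (card (fiber A B y)))\<^sup>2) =
        (\<Sum>y\<in>F2vecs t. \<Sum>x\<in>B. \<Sum>x'\<in>B.
          if F2apply A x = y then if F2apply A x' = y then 1 else 0 else 0)"
      unfolding fiber_def card_eq_sum_indicator[OF fB] power2_eq_square sum_product
      by (intro sum.cong refl) auto
    also have "\<dots> = (\<Sum>x\<in>B. \<Sum>x'\<in>B. \<Sum>y\<in>F2vecs t.
          if F2apply A x = y then if F2apply A x' = y then 1 else 0 else 0)"
      by (subst sum.swap, rule sum.cong[OF refl], rule sum.swap)
    also have "\<dots> = (\<Sum>x\<in>B. \<Sum>x'\<in>B. if F2apply A x = F2apply A x' then 1 else 0)"
      using F2apply_in_F2vecs[OF A] by (intro sum.cong refl) auto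
    finally show ?thesis .
  qed
  \<comment> \<open>For \<open>x = x'\<close> the first summand is pure slack: it makes the double
    sum come to exactly the mean term that is subtracted.\<close>
  have coll: "(\<Sum>A\<in>F2mats t n. if F2apply A x = F2apply A x' then 1 else 0) \<le>
      ?N / 2 ^ t + (if x = x' then ?N else 0)" if "x \<in> B" "x' \<in> B" for x x'
  proof (cases "x = x'")
    case False
    have "x \<in> F2vecs n" "x' \<in> F2vecs n" using that B by auto
    from F2apply_collision[OF this False, of t]
    have "real (2 ^ t * card {A \<in> F2mats t n. F2apply A x = F2apply A x'}) = ?N"
      by (rule arg_cong)
    then have "real (card {A \<in> F2mats t n. F2apply A x = F2apply A x'}) = ?N / 2 ^ t"
      by (simp add: field_simps)
    then show ?thesis using False
      unfolding card_eq_sum_indicator[OF finite_F2mats] by simp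
  qed simp
  have "(\<Sum>A\<in>F2mats t n. \<Sum>y\<in>F2vecs t. (real (card (fiber A B y)) - ?b / 2 ^ t)\<^sup>2) =
      (\<Sum>A\<in>F2mats t n. (\<Sum>x\<in>B. \<Sum>x'\<in>B. if F2apply A x = F2apply A x' then 1 else 0) - ?b\<^sup>2 / 2 ^ t)"
  proof (rule sum.cong[OF refl])
    fix A assume A: "A \<in> F2mats t n"
    have "(\<Sum>y\<in>F2vecs t. (real (card (fiber A B y)) - ?b / 2 ^ t)\<^sup>2) =
        (\<Sum>y\<in>F2vecs t. (real (card (fiber A B y)))\<^sup>2)
        - 2 * (?b / 2 ^ t) * (\<Sum>y\<in>F2vecs t. real (card (fiber A B y)))
        + 2 ^ t * (?b / 2 ^ t)\<^sup>2"
      unfolding power2_diff sum.distrib sum_subtractf sum_distrib_left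
      by (simp add: mult_ac)
    also have "\<dots> = (\<Sum>x\<in>B. \<Sum>x'\<in>B. if F2apply A x = F2apply A x' then 1 else 0) - ?b\<^sup>2 / 2 ^ t"
      unfolding lin[OF A] sq[OF A] by (simp add: field_simps power2_eq_square)
    finally show "(\<Sum>y\<in>F2vecs t. (real (card (fiber A B y)) - ?b / 2 ^ t)\<^sup>2) =
      (\<Sum>x\<in>B. \<Sum>x'\<in>B. if F2apply A x = F2apply A x' then 1 else 0) - ?b\<^sup>2 / 2 ^ t" .
  qed
  also have "\<dots> = (\<Sum>A\<in>F2mats t n. \<Sum>x\<in>B. \<Sum>x'\<in>B. if F2apply A x = F2apply A x' then 1 else 0)
      - ?N * (?b\<^sup>2 / 2 ^ t)"
    by (simp add: sum_subtractf)
  also have "(\<Sum>A\<in>F2mats t n. \<Sum>x\<in>B. \<Sum>x'\<in>B. if F2apply A x = F2apply A x' then 1 else 0) =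
      (\<Sum>x\<in>B. \<Sum>x'\<in>B. \<Sum>A\<in>F2mats t n. if F2apply A x = F2apply A x' then 1 else (0::real))"
    by (subst sum.swap, rule sum.cong[OF refl], rule sum.swap)
  also have "\<dots> \<le> (\<Sum>x\<in>B. \<Sum>x'\<in>B. ?N / 2 ^ t + (if x = x' then ?N else 0))"
    by (intro sum_mono coll)
  also have "\<dots> = ?N * (?b\<^sup>2 / 2 ^ t) + ?N * ?b"
    using fB by (simp add: sum.distrib power2_eq_square algebra_simps)
  finally show ?thesis by simp
qed

subsection \<open>Random shears\<close>

text \<open>The rank-one update \<open>A + u r^T\<close>. With \<open>r\<close> stacked on top of
  \<open>A\<close>, it is the shear \<open>(b, y) \<mapsto> (b, y + b u)\<close> of the
  target.\<close>

definition F2shear :: "bool list \<Rightarrow> bool list \<Rightarrow> bool list list \<Rightarrow> bool list list" where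
  "F2shear r u A = map2 (\<lambda>b a. if b then F2add a r else a) u A"

lemma F2shear_in_F2mats:
  assumes "r \<in> F2vecs n" "u \<in> F2vecs m" "A \<in> F2mats m n"
  shows "F2shear r u A \<in> F2mats m n"
  using assms by (auto simp: F2shear_def F2mats_def F2vecs_def dest: set_zip_rightD)

lemma F2shear_F2shear:
  assumes "r \<in> F2vecs n" "u \<in> F2vecs m" "A \<in> F2mats m n"
  shows "F2shear r u (F2shear r u A) = A"
proof -
  have "length u = length A" "\<forall>a\<in>set A. length a = length r"
    using assms by (auto simp: F2mats_def F2vecs_def)
  then show ?thesis
    by (induction u A rule: list_induct2) (auto simp: F2shear_def F2add_cancel_right)
qed

lemma bij_betw_F2shear:
  assumes "r \<in> F2vecs n" "u \<in> F2vecs m"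
  shows "bij_betw (F2shear r u) (F2mats m n) (F2mats m n)"
  by (rule bij_betw_byWitness[where f' = "F2shear r u"])
     (auto simp: F2shear_F2shear[OF assms] F2shear_in_F2mats[OF assms])

lemma F2apply_F2shear:
  assumes "r \<in> F2vecs n" "u \<in> F2vecs m" "A \<in> F2mats m n" "x \<in> F2vecs n"
  shows "F2apply (F2shear r u A) x =
    (if F2dot r x then F2add (F2apply A x) u else F2apply A x)"
proof -
  have "length u = length A" "\<forall>a\<in>set A. length a = length r" "length r = length x"
    using assms by (auto simp: F2mats_def F2vecs_def)
  then show ?thesis
    by (induction u A rule: list_induct2) (auto simp: F2shear_def F2apply_def F2dot_add_left)
qed

text \<open>The probability that \<open>F_2^k \<times> {y}\<close> is contained, for some \<open>y\<close>, in the image of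
  \<open>H \<subseteq> F_2^(t+k)\<close> under \<open>k\<close> random shears.  The shear by \<open>u\<close> adds \<open>u\<close> to the remaining
  coordinates of the points with first coordinate \<open>True\<close>.\<close>

fun coset_prob :: "nat \<Rightarrow> nat \<Rightarrow> bool list set \<Rightarrow> real" where
  "coset_prob t 0 H = (if H = {} then 0 else 1)"
| "coset_prob t (Suc k) H =
    (\<Sum>u\<in>F2vecs (t + k). coset_prob t k {y \<in> F2vecs (t + k). False # y \<in> H \<and> True # F2add y u \<in> H})
      / 2 ^ (t + k)"

lemma coset_prob_nonneg: "0 \<le> coset_prob t k H"
  by (induction k arbitrary: H) (auto intro!: sum_nonneg divide_nonneg_pos)

lemma coset_prob_le_1: "coset_prob t k H \<le> 1"
proof (induction k arbitrary: H)
  case (Suc k)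
  have "(\<Sum>u\<in>F2vecs (t + k). coset_prob t k {y \<in> F2vecs (t + k). False # y \<in> H \<and> True # F2add y u \<in> H})
    \<le> (\<Sum>u\<in>F2vecs (t + k). 1)"
    by (intro sum_mono Suc)
  then show ?case by simp
qed simp

text \<open>For fixed \<open>y\<close> the shift \<open>u \<mapsto> y + u\<close> permutes the
  space, so exactly \<open>card Q\<close> of the \<open>u\<close> move \<open>y\<close> into
  \<open>Q\<close>. In densities: after a random translation two sets meet, on average, in the
  product of their densities.\<close>

lemma sum_card_shifted_Int:
  assumes "P \<subseteq> F2vecs m" "Q \<subseteq> F2vecs m"
  shows "(\<Sum>u\<in>F2vecs m. real (card {y \<in> P. F2add y u \<in> Q})) = real (card P) * real (card Q)"
proof -
  have fin: "finite P" "finite Q" using assms finite_F2vecs finite_subset by blast+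
  have shift: "card {u \<in> F2vecs m. F2add y u \<in> Q} = card Q" if "y \<in> P" for y
  proof -
    have "bij_betw (F2add y) (F2vecs m) (F2vecs m)" using bij_betw_F2add that assms by blast
    then have inj: "inj_on (F2add y) (F2vecs m)" and im: "F2add y ` F2vecs m = F2vecs m"
      by (auto simp: bij_betw_def)
    have "F2add y ` {u \<in> F2vecs m. F2add y u \<in> Q} = Q"
    proof -
      have "F2add y ` {u \<in> F2vecs m. F2add y u \<in> Q} = F2add y ` F2vecs m \<inter> Q" by auto
      then show ?thesis using im assms by auto
    qed
    moreover have "inj_on (F2add y) {u \<in> F2vecs m. F2add y u \<in> Q}"
      using inj by (rule inj_on_subset) auto
    ultimately show ?thesis by (metis card_image)
  qed
  have "(\<Sum>u\<in>F2vecs m. real (card {y \<in> P. F2add y u \<in> Q})) =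
      (\<Sum>u\<in>F2vecs m. \<Sum>y\<in>P. if F2add y u \<in> Q then 1 else 0)"
    by (simp add: card_eq_sum_indicator fin)
  also have "\<dots> = (\<Sum>y\<in>P. \<Sum>u\<in>F2vecs m. if F2add y u \<in> Q then 1 else 0)"
    by (rule sum.swap)
  also have "\<dots> = (\<Sum>y\<in>P. real (card Q))"
    using shift by (intro sum.cong refl) (simp add: card_eq_sum_indicator[symmetric])
  finally show ?thesis by simp
qed

text \<open>The halves \<open>P\<close> and \<open>Q\<close> of \<open>H\<close>, cut by the first
  coordinate, overlap after a random shear in a set whose expected density is at most the square of
  that of \<open>H\<close>, by the arithmetic-geometric mean inequality. The induction hypothesis,
  linear in the size, passes to this average.\<close>

lemma coset_prob_le_density:
  "H \<subseteq> F2vecs (t + k) \<Longrightarrow> coset_prob t k H \<le> 2 powr (real t / 2 ^ k) * real (card H) / 2 ^ (t + k)"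
proof (induction k arbitrary: H)
  case 0
  then have "finite H" using finite_F2vecs finite_subset by blast
  \<comment> \<open>A non-empty subset of \<open>F_2^t\<close> has density at least
    \<open>2^(-t)\<close>, hence the initial constant \<open>2^t\<close>.\<close>
  then have "H \<noteq> {} \<Longrightarrow> card H \<ge> 1"
    by (simp add: Suc_le_eq card_gt_0_iff)
  then show ?case by (simp add: powr_realpow)
next
  case (Suc k)
  define m where "m = t + k"
  define P where "P = {y \<in> F2vecs m. False # y \<in> H}"
  define Q where "Q = {y \<in> F2vecs m. True # y \<in> H}"
  define K where "K = 2 powr (real t / 2 ^ k)"
  have HS: "H = Cons False ` P \<union> Cons True ` Q"
  proof (intro equalityI subsetI)
    fix z assume z: "z \<in> H"
    then obtain b y where "z = b # y" "y \<in> F2vecs m"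
      using Suc.prems by (auto simp: F2vecs_Suc m_def)
    then show "z \<in> Cons False ` P \<union> Cons True ` Q"
      using z by (cases b) (auto simp: P_def Q_def)
  qed (auto simp: P_def Q_def)
  have "card H = card (Cons False ` P) + card (Cons True ` Q)"
    unfolding HS by (rule card_Un_disjoint) (auto simp: P_def Q_def)
  then have cH: "card H = card P + card Q"
    by (simp add: card_image)
  define z where "z = K * (real (card H) / 2 ^ Suc m)\<^sup>2"
  have "coset_prob t (Suc k) H =
      (\<Sum>u\<in>F2vecs m. coset_prob t k {y \<in> F2vecs m. False # y \<in> H \<and> True # F2add y u \<in> H}) / 2 ^ m"
    by (simp add: m_def)
  also have "\<dots> \<le> (\<Sum>u\<in>F2vecs m. K * real (card {y \<in> P. F2add y u \<in> Q}) / 2 ^ m) / 2 ^ m"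
  proof (intro divide_right_mono sum_mono)
    fix u assume u: "u \<in> F2vecs m"
    have "{y \<in> F2vecs m. False # y \<in> H \<and> True # F2add y u \<in> H} = {y \<in> P. F2add y u \<in> Q}"
      using u by (auto simp: P_def Q_def F2add_in_F2vecs)
    then show "coset_prob t k {y \<in> F2vecs m. False # y \<in> H \<and> True # F2add y u \<in> H} \<le>
        K * real (card {y \<in> P. F2add y u \<in> Q}) / 2 ^ m"
      using Suc.IH[of "{y \<in> P. F2add y u \<in> Q}"] by (auto simp: K_def m_def P_def)
  qed simp
  also have "\<dots> = K * (real (card P) * real (card Q)) / (2 ^ m)\<^sup>2"
    using sum_card_shifted_Int[of P m Q]
    by (simp add: P_def Q_def sum_divide_distrib[symmetric] sum_distrib_left[symmetric]
        power2_eq_square)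
  also have "\<dots> \<le> K * (real (card H) / 2)\<^sup>2 / (2 ^ m)\<^sup>2"
  proof -
    have "0 \<le> (real (card P) - real (card Q))\<^sup>2" by simp
    then have "real (card P) * real (card Q) \<le> (real (card H) / 2)\<^sup>2"
      by (simp add: cH power2_eq_square field_simps)
    then show ?thesis by (intro divide_right_mono mult_left_mono) (auto simp: K_def)
  qed
  also have "\<dots> = z" by (simp add: z_def power_divide power_mult_distrib)
  finally have le_z: "coset_prob t (Suc k) H \<le> z" .
  have z0: "z \<ge> 0" by (simp add: z_def K_def)
  \<comment> \<open>A probability bounded by \<open>z\<close> is bounded by \<open>sqrt z\<close>; this halves the exponent of the constant
    and makes the bound linear in the density again, so that it can be averaged in the next step.\<close>
  have "coset_prob t (Suc k) H \<le> sqrt z"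
  proof (rule real_le_rsqrt)
    have "(coset_prob t (Suc k) H)\<^sup>2 \<le> coset_prob t (Suc k) H * 1"
      unfolding power2_eq_square by (intro mult_left_mono coset_prob_le_1 coset_prob_nonneg)
    then show "(coset_prob t (Suc k) H)\<^sup>2 \<le> z" using le_z by linarith
  qed
  also have "\<dots> = sqrt K * (real (card H) / 2 ^ Suc m)"
    by (simp add: z_def real_sqrt_mult)
  also have "sqrt K = 2 powr (real t / 2 ^ Suc k)"
    by (simp add: K_def powr_half_sqrt[symmetric] powr_powr mult.commute)
  finally show ?case by (simp add: m_def)
qed

text \<open>For fixed \<open>r\<close>, adding \<open>r\<close> to the rows of a uniform \<open>A\<close> selected by \<open>u\<close> leaves \<open>A\<close> uniform
  and shears the cells of \<open>r # A\<close>, so the random shears can be absorbed into the random map.\<close>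

lemma sum_coset_prob_eq_card:
  "(\<Sum>A\<in>F2mats (t + k) n. coset_prob t k {y \<in> F2vecs (t + k). q (fiber A (F2vecs n) y)}) =
    real (card {A \<in> F2mats (t + k) n.
      \<exists>y\<in>F2vecs t. \<forall>c\<in>F2vecs k. q (fiber A (F2vecs n) (c @ y))})"
proof (induction k arbitrary: q)
  case 0
  then show ?case
    by (subst card_eq_sum_indicator) (auto simp: F2vecs_0 intro!: sum.cong)
next
  case (Suc k)
  define m where "m = t + k"
  \<comment> \<open>\<open>q\<close> sees the fiber as a set and not only its size, because
    \<open>q' r\<close> has to cut it by \<open>F2dot r\<close> and test both halves.\<close>
  define q' where "q' = (\<lambda>r X. q {x \<in> X. \<not> F2dot r x} \<and> q {x \<in> X. F2dot r x})"
  have fiber_Cons: "fiber (r # A) B (b # y) = {x \<in> fiber A B y. F2dot r x = b}"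
    for r A B b y by (auto simp: fiber_def F2apply_Cons)
  have step: "coset_prob t (Suc k) {y \<in> F2vecs (Suc m). q (fiber (r # A) (F2vecs n) y)} =
     (\<Sum>u\<in>F2vecs m. coset_prob t k {y \<in> F2vecs m. q' r (fiber (F2shear r u A) (F2vecs n) y)}) / 2 ^ m"
    if rA: "r \<in> F2vecs n" "A \<in> F2mats m n" for r A
  proof -
    have "{y \<in> F2vecs m. False # y \<in> {y \<in> F2vecs (Suc m). q (fiber (r # A) (F2vecs n) y)} \<and>
            True # F2add y u \<in> {y \<in> F2vecs (Suc m). q (fiber (r # A) (F2vecs n) y)}} =
          {y \<in> F2vecs m. q' r (fiber (F2shear r u A) (F2vecs n) y)}" (is "?l = ?r")
      if u: "u \<in> F2vecs m" for u
    proof -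
      \<comment> \<open>In a fiber of the sheared map, points with \<open>F2dot r x\<close> false
        keep their value under \<open>A\<close>, and those with it true have value
        \<open>y + u\<close> under \<open>A\<close>. So its halves are two cells of
        \<open>r # A\<close>, the ones that the shear by \<open>u\<close> pairs.\<close>
      have 0: "{x \<in> fiber (F2shear r u A) (F2vecs n) y. \<not> F2dot r x} =
          fiber (r # A) (F2vecs n) (False # y)" for y
        using F2apply_F2shear[OF rA(1) u rA(2)] by (auto simp: fiber_def F2apply_Cons)
      have 1: "{x \<in> fiber (F2shear r u A) (F2vecs n) y. F2dot r x} =
          fiber (r # A) (F2vecs n) (True # F2add y u)" if y: "y \<in> F2vecs m" for y
      proof -
        have eq: "F2add (F2apply A x) u = y \<longleftrightarrow> F2apply A x = F2add y u" for x
          using F2apply_in_F2vecs[OF rA(2), of x] u y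
          by (intro F2add_eq_iff) (auto simp: F2vecs_def)
        have "x \<in> {x \<in> fiber (F2shear r u A) (F2vecs n) y. F2dot r x} \<longleftrightarrow>
            x \<in> fiber (r # A) (F2vecs n) (True # F2add y u)" for x
          by (cases "x \<in> F2vecs n"; cases "F2dot r x")
             (simp_all add: fiber_def F2apply_Cons F2apply_F2shear[OF rA(1) u rA(2)] eq)
        then show ?thesis by blast
      qed
      have "False # y \<in> F2vecs (Suc m)" "True # F2add y u \<in> F2vecs (Suc m)"
        if "y \<in> F2vecs m" for y using u that by (auto simp: F2vecs_def)
      then show ?thesis using 0 1 by (auto simp: q'_def)
    qed
    then show ?thesis by (simp add: m_def[symmetric])
  qed
  have "(\<Sum>A\<in>F2mats (t + Suc k) n.
        coset_prob t (Suc k) {y \<in> F2vecs (t + Suc k). q (fiber A (F2vecs n) y)}) =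
      (\<Sum>r\<in>F2vecs n. \<Sum>A\<in>F2mats m n.
        coset_prob t (Suc k) {y \<in> F2vecs (Suc m). q (fiber (r # A) (F2vecs n) y)})"
    by (simp only: add_Suc_right sum_F2mats_Suc m_def)
  also have "\<dots> = (\<Sum>r\<in>F2vecs n. \<Sum>A\<in>F2mats m n.
      (\<Sum>u\<in>F2vecs m. coset_prob t k {y \<in> F2vecs m. q' r (fiber (F2shear r u A) (F2vecs n) y)}) / 2 ^ m)"
    by (intro sum.cong refl step)
  also have "\<dots> = (\<Sum>r\<in>F2vecs n. (\<Sum>u\<in>F2vecs m. \<Sum>A\<in>F2mats m n.
      coset_prob t k {y \<in> F2vecs m. q' r (fiber (F2shear r u A) (F2vecs n) y)}) / 2 ^ m)"
    by (subst (2) sum.swap) (simp add: sum_divide_distrib[symmetric])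
  also have "\<dots> = (\<Sum>r\<in>F2vecs n. (\<Sum>u\<in>F2vecs m. \<Sum>A\<in>F2mats m n.
      coset_prob t k {y \<in> F2vecs m. q' r (fiber A (F2vecs n) y)}) / 2 ^ m)"
    by (intro sum.cong refl arg_cong2[where f = "(/)"] sum.reindex_bij_betw[OF bij_betw_F2shear])
  \<comment> \<open>The summand no longer depends on \<open>u\<close>, so averaging over
    \<open>u\<close> drops out.\<close>
  also have "\<dots> = (\<Sum>r\<in>F2vecs n. real (card {A \<in> F2mats m n.
      \<exists>y\<in>F2vecs t. \<forall>c\<in>F2vecs k. q' r (fiber A (F2vecs n) (c @ y))}))"
    using Suc.IH by (simp add: m_def)
  also have "\<dots> = (\<Sum>r\<in>F2vecs n. \<Sum>A\<in>F2mats m n. if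
      \<exists>y\<in>F2vecs t. \<forall>c\<in>F2vecs (Suc k). q (fiber (r # A) (F2vecs n) (c @ y)) then 1 else 0)"
  proof (rule sum.cong[OF refl], subst card_eq_sum_indicator[OF finite_F2mats], rule sum.cong[OF refl])
    fix r A
    have "(\<forall>c\<in>F2vecs (Suc k). q (fiber (r # A) (F2vecs n) (c @ y))) \<longleftrightarrow>
          (\<forall>c\<in>F2vecs k. q' r (fiber A (F2vecs n) (c @ y)))" for y
      by (simp add: ball_F2vecs_Suc fiber_Cons q'_def)
    then show "(if \<exists>y\<in>F2vecs t. \<forall>c\<in>F2vecs k. q' r (fiber A (F2vecs n) (c @ y)) then 1 else 0) =
      (if \<exists>y\<in>F2vecs t. \<forall>c\<in>F2vecs (Suc k). q (fiber (r # A) (F2vecs n) (c @ y)) then 1 else (0::real))"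
      by simp
  qed
  also have "\<dots> = real (card {A \<in> F2mats (Suc m) n.
      \<exists>y\<in>F2vecs t. \<forall>c\<in>F2vecs (Suc k). q (fiber A (F2vecs n) (c @ y))})"
    by (subst card_eq_sum_indicator[OF finite_F2mats]) (simp only: sum_F2mats_Suc)
  finally show ?case by (simp add: m_def)
qed

subsection \<open>Largest buckets\<close>

text \<open>Markov's inequality for the second moment: one light cell already contributes
  \<open>2 * card B\<close>, twice the bound on the average of the whole sum.\<close>

lemma few_maps_with_light_cell:
  assumes B: "B \<subseteq> F2vecs n" "B \<noteq> {}"
    and \<theta>: "\<theta> \<le> real (card B) / 2 ^ d" "2 * real (card B) \<le> (real (card B) / 2 ^ d - \<theta>)\<^sup>2"
  shows "2 * real (card {R \<in> F2mats d n. \<exists>c\<in>F2vecs d. real (card (fiber R B c)) < \<theta>})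
    \<le> real (card (F2mats d n))"
proof -
  let ?b = "real (card B)"
  let ?E = "{R \<in> F2mats d n. \<exists>c\<in>F2vecs d. real (card (fiber R B c)) < \<theta>}"
  have b: "?b > 0" using B finite_subset[OF B(1)] by (simp add: card_gt_0_iff)
  have "real (card ?E) * (2 * ?b) = (\<Sum>R\<in>?E. 2 * ?b)" by simp
  also have "\<dots> \<le> (\<Sum>R\<in>?E. \<Sum>c\<in>F2vecs d. (real (card (fiber R B c)) - ?b / 2 ^ d)\<^sup>2)"
  proof (rule sum_mono)
    fix R assume "R \<in> ?E"
    then obtain c where c: "c \<in> F2vecs d" "real (card (fiber R B c)) < \<theta>" by auto
    have "(?b / 2 ^ d - \<theta>)\<^sup>2 \<le> (?b / 2 ^ d - real (card (fiber R B c)))\<^sup>2"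
      using c \<theta>(1) by (intro power_mono) auto
    then have "2 * ?b \<le> (real (card (fiber R B c)) - ?b / 2 ^ d)\<^sup>2"
      using \<theta>(2) by (simp add: power2_commute)
    also have "\<dots> \<le> (\<Sum>c\<in>F2vecs d. (real (card (fiber R B c)) - ?b / 2 ^ d)\<^sup>2)"
      using c(1) by (intro member_le_sum) auto
    finally show "2 * ?b \<le> (\<Sum>c\<in>F2vecs d. (real (card (fiber R B c)) - ?b / 2 ^ d)\<^sup>2)" .
  qed
  also have "\<dots> \<le> (\<Sum>R\<in>F2mats d n. \<Sum>c\<in>F2vecs d. (real (card (fiber R B c)) - ?b / 2 ^ d)\<^sup>2)"
    by (intro sum_mono2) (auto intro: sum_nonneg)
  also have "\<dots> \<le> real (card (F2mats d n)) * ?b" by (rule second_moment[OF B(1)])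
  finally show ?thesis using b by simp
qed

text \<open>Chebyshev's inequality: each heavy cell contributes at least \<open>a^2\<close> to the
  second moment.\<close>

lemma sum_heavy_cells:
  assumes S: "S \<subseteq> F2vecs n" and a: "a \<ge> 0"
  shows "(\<Sum>A\<in>F2mats m n. real (card {y \<in> F2vecs m.
      real (card S) / 2 ^ m + a \<le> real (card (fiber A S y))})) * a\<^sup>2
    \<le> real (card (F2mats m n)) * real (card S)"
proof -
  let ?H = "\<lambda>A. {y \<in> F2vecs m. real (card S) / 2 ^ m + a \<le> real (card (fiber A S y))}"
  have "(\<Sum>A\<in>F2mats m n. real (card (?H A))) * a\<^sup>2 = (\<Sum>A\<in>F2mats m n. \<Sum>y\<in>?H A. a\<^sup>2)"
    by (simp add: sum_distrib_right)
  also have "\<dots> \<le> (\<Sum>A\<in>F2mats m n. \<Sum>y\<in>?H A. (real (card (fiber A S y)) - real (card S) / 2 ^ m)\<^sup>2)"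
    using a by (intro sum_mono power_mono) auto
  also have "\<dots> \<le> (\<Sum>A\<in>F2mats m n. \<Sum>y\<in>F2vecs m. (real (card (fiber A S y)) - real (card S) / 2 ^ m)\<^sup>2)"
    by (intro sum_mono sum_mono2) auto
  also have "\<dots> \<le> real (card (F2mats m n)) * real (card S)" by (rule second_moment[OF S])
  finally show ?thesis .
qed

text \<open>Double counting of pairs of a map \<open>L\<close> with an overfull bucket and a
  refinement \<open>R\<close>. At least half of all \<open>R\<close> put \<open>R @ L\<close> into
  \<open>G\<close>, the maps with a whole coset of heavy cells; and by the shear bound
  \<open>card G\<close> is at most twice the summed density of heavy cells. These two factors 2 give
  the 4.\<close>

lemma card_maps_with_large_bucket:
  fixes n t d :: nat and \<tau> \<mu> :: real
  assumes S: "S \<subseteq> F2vecs n" "S \<noteq> {}" and \<tau>: "\<tau> > 1" and t: "t \<le> 2 ^ d"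
    and \<mu>: "\<mu> = real (card S) / 2 ^ t"
    and large: "2 * (2 ^ d)\<^sup>2 * (1 + \<tau>) \<le> (\<tau> - sqrt \<tau>)\<^sup>2 * \<mu>"
  shows "real (card {L \<in> F2mats t n. \<exists>y\<in>F2vecs t. (1 + \<tau>) * \<mu> < real (card (fiber L S y))}) * (\<tau> * \<mu>)
    \<le> 4 * 2 ^ d * real (card (F2mats t n))"
proof -
  define D :: real where "D = 2 ^ d"
  define g where "g = \<tau> - sqrt \<tau>"
  \<comment> \<open>In units of \<open>\<mu> / D\<close>, the threshold lies
    \<open>sqrt \<tau>\<close> above the average cell of \<open>S\<close>, a gap that squares to
    \<open>\<tau>\<close>, and \<open>g\<close> below the level \<open>1 + \<tau>\<close> that the
    average cell of an overfull bucket exceeds.\<close>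
  define \<theta> where "\<theta> = (1 + sqrt \<tau>) * \<mu> / D"
  define q where "q = (\<lambda>X. \<theta> \<le> real (card (X \<inter> S)))"
  define Bad where "Bad = {L \<in> F2mats t n. \<exists>y\<in>F2vecs t. (1 + \<tau>) * \<mu> < real (card (fiber L S y))}"
  define G where "G = {A \<in> F2mats (t + d) n.
      \<exists>y\<in>F2vecs t. \<forall>c\<in>F2vecs d. q (fiber A (F2vecs n) (c @ y))}"
  define H where "H = (\<lambda>A. {y \<in> F2vecs (t + d). q (fiber A (F2vecs n) y)})"
  have finS: "finite S" using S finite_F2vecs finite_subset by blast
  then have S0: "real (card S) > 0" using S by (simp add: card_gt_0_iff)
  have D0: "D > 0" by (simp add: D_def)
  have \<mu>0: "\<mu> > 0" using S0 \<mu> by simp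
  have g0: "g > 0" using \<tau> by (simp add: g_def real_less_lsqrt power2_eq_square)
  have q_fiber: "q (fiber A (F2vecs n) y) \<longleftrightarrow> \<theta> \<le> real (card (fiber A S y))" for A y
  proof -
    have "fiber A (F2vecs n) y \<inter> S = fiber A S y" using S by (auto simp: fiber_def)
    then show ?thesis by (simp add: q_def)
  qed
  have many: "real (card (F2mats d n)) \<le> 2 * real (card {R \<in> F2mats d n. R @ L \<in> G})"
    if L: "L \<in> Bad" for L
  proof -
    obtain y where y: "y \<in> F2vecs t" "(1 + \<tau>) * \<mu> < real (card (fiber L S y))"
      using L by (auto simp: Bad_def)
    have Lm: "L \<in> F2mats t n" using L by (simp add: Bad_def)
    define B where "B = fiber L S y"
    define b where "b = real (card B)"
    have b: "(1 + \<tau>) * \<mu> < b" using y by (simp add: b_def B_def)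
    have "0 < (1 + \<tau>) * \<mu>" using \<tau> \<mu>0 by simp
    then have b0: "b > 0" using b by linarith
    have "B \<noteq> {}" using b0 by (auto simp: b_def)
    moreover have "B \<subseteq> F2vecs n" using S by (auto simp: B_def fiber_def)
    ultimately have B: "B \<subseteq> F2vecs n" "B \<noteq> {}" by auto
    \<comment> \<open>As \<open>\<mu> < b / (1 + \<tau>)\<close>, the gap is at least a fixed
      fraction of \<open>b\<close>, so it beats the deviation of order \<open>sqrt b\<close> for
      every overfull bucket, however large.\<close>
    have k: "b * g / (1 + \<tau>) \<le> b - (1 + sqrt \<tau>) * \<mu>"
    proof -
      have "(1 + sqrt \<tau>) * ((1 + \<tau>) * \<mu>) \<le> (1 + sqrt \<tau>) * b"
        using b \<tau> by (intro mult_left_mono) auto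
      then show ?thesis using \<tau> by (simp add: g_def field_simps)
    qed
    have bg: "0 < b * g / (1 + \<tau>)" using b0 g0 \<tau> by simp
    have "2 * b \<le> (b / D - \<theta>)\<^sup>2"
    proof -
      have "2 * D\<^sup>2 * (1 + \<tau>)\<^sup>2 = (2 * D\<^sup>2 * (1 + \<tau>)) * (1 + \<tau>)"
        by (simp add: power2_eq_square)
      also have "\<dots> \<le> (g\<^sup>2 * \<mu>) * (1 + \<tau>)"
        using large \<tau> by (intro mult_right_mono) (auto simp: D_def g_def)
      also have "\<dots> \<le> g\<^sup>2 * b"
        using b by (simp add: mult.assoc mult.commute[of \<mu>] mult_left_mono)
      finally have "2 * D\<^sup>2 * (1 + \<tau>)\<^sup>2 * b \<le> g\<^sup>2 * b * b"
        using b0 by (intro mult_right_mono) auto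
      then have "2 * b * D\<^sup>2 \<le> (b * g / (1 + \<tau>))\<^sup>2"
        using \<tau> by (simp add: power_divide power_mult_distrib pos_le_divide_eq power2_eq_square mult_ac)
      also have "\<dots> \<le> (b - (1 + sqrt \<tau>) * \<mu>)\<^sup>2"
        using k bg by (intro power_mono) auto
      finally have "2 * b \<le> (b - (1 + sqrt \<tau>) * \<mu>)\<^sup>2 / D\<^sup>2"
        using D0 by (simp add: pos_le_divide_eq)
      also have "\<dots> = (b / D - \<theta>)\<^sup>2"
        by (simp add: \<theta>_def power_divide[symmetric] diff_divide_distrib)
      finally show ?thesis .
    qed
    moreover have "\<theta> \<le> b / D"
      using k bg D0 by (simp add: \<theta>_def divide_right_mono)
    ultimately have light: "2 * real (card {R \<in> F2mats d n. \<exists>c\<in>F2vecs d. real (card (fiber R B c)) < \<theta>})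
        \<le> real (card (F2mats d n))"
      using few_maps_with_light_cell[OF B, of \<theta> d] by (simp add: b_def D_def)
    have sub: "F2mats d n - {R \<in> F2mats d n. \<exists>c\<in>F2vecs d. real (card (fiber R B c)) < \<theta>}
        \<subseteq> {R \<in> F2mats d n. R @ L \<in> G}"
    proof
      fix R assume "R \<in> F2mats d n - {R \<in> F2mats d n. \<exists>c\<in>F2vecs d. real (card (fiber R B c)) < \<theta>}"
      then have R: "R \<in> F2mats d n" "\<And>c. c \<in> F2vecs d \<Longrightarrow> \<theta> \<le> real (card (fiber R B c))"
        by (auto simp: not_less)
      have "fiber (R @ L) S (c @ y) = fiber R B c" if "c \<in> F2vecs d" for c
        using R(1) that by (auto simp: fiber_def B_def F2apply_append F2apply_def F2mats_def F2vecs_def)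
      then have "\<forall>c\<in>F2vecs d. q (fiber (R @ L) (F2vecs n) (c @ y))"
        using R(2) by (simp add: q_fiber)
      moreover have "R @ L \<in> F2mats (t + d) n"
        using R(1) Lm by (auto simp: F2mats_def)
      ultimately show "R \<in> {R \<in> F2mats d n. R @ L \<in> G}" using R(1) y(1) by (auto simp: G_def)
    qed
    have "real (card (F2mats d n)) - real (card {R \<in> F2mats d n. \<exists>c\<in>F2vecs d. real (card (fiber R B c)) < \<theta>})
        = real (card (F2mats d n - {R \<in> F2mats d n. \<exists>c\<in>F2vecs d. real (card (fiber R B c)) < \<theta>}))"
      by (subst card_Diff_subset) (auto simp: of_nat_diff card_mono)
    also have "\<dots> \<le> real (card {R \<in> F2mats d n. R @ L \<in> G})"
      using sub by (intro of_nat_mono card_mono) auto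
    finally show ?thesis using light by linarith
  qed
  have "real (card Bad) * real (card (F2mats d n)) = (\<Sum>L\<in>Bad. real (card (F2mats d n)))"
    by simp
  also have "\<dots> \<le> (\<Sum>L\<in>Bad. 2 * real (card {R \<in> F2mats d n. R @ L \<in> G}))"
    by (intro sum_mono many)
  also have "\<dots> = 2 * real (card (SIGMA L:Bad. {R \<in> F2mats d n. R @ L \<in> G}))"
    by (subst card_SigmaI) (auto simp: Bad_def sum_distrib_left)
  \<comment> \<open>\<open>R\<close> and \<open>L\<close> have fixed lengths, so
    \<open>R @ L\<close> determines both.\<close>
  also have "card (SIGMA L:Bad. {R \<in> F2mats d n. R @ L \<in> G}) \<le> card G"
  proof (rule card_inj_on_le[where f = "\<lambda>(L, R). R @ L"])
    show "inj_on (\<lambda>(L, R). R @ L) (SIGMA L:Bad. {R \<in> F2mats d n. R @ L \<in> G})"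
      by (auto simp: inj_on_def F2mats_def)
  qed (auto simp: G_def)
  finally have Bad_G: "real (card Bad) * real (card (F2mats d n)) \<le> 2 * real (card G)" by simp
  have "real (card G) = (\<Sum>A\<in>F2mats (t + d) n. coset_prob t d (H A))"
    unfolding G_def H_def by (rule sum_coset_prob_eq_card[symmetric])
  also have "\<dots> \<le> (\<Sum>A\<in>F2mats (t + d) n. 2 * real (card (H A)) / 2 ^ (t + d))"
  proof (rule sum_mono)
    fix A
    have "coset_prob t d (H A) \<le> 2 powr (real t / 2 ^ d) * real (card (H A)) / 2 ^ (t + d)"
      by (rule coset_prob_le_density) (auto simp: H_def)
    also have "2 powr (real t / 2 ^ d) \<le> 2 powr 1"
      using t by (intro powr_mono) (auto simp: divide_le_eq_1 simp flip: of_nat_le_iff)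
    finally show "coset_prob t d (H A) \<le> 2 * real (card (H A)) / 2 ^ (t + d)"
      by (simp add: divide_right_mono mult_right_mono)
  qed
  also have "\<dots> = 2 / 2 ^ (t + d) * (\<Sum>A\<in>F2mats (t + d) n. real (card (H A)))"
    by (simp add: sum_distrib_left)
  finally have G_H: "real (card G) \<le> 2 / 2 ^ (t + d) * (\<Sum>A\<in>F2mats (t + d) n. real (card (H A)))" .
  have "\<theta> = real (card S) / 2 ^ (t + d) + sqrt \<tau> * \<mu> / D"
    by (simp add: \<theta>_def \<mu> D_def power_add field_simps)
  then have "(\<Sum>A\<in>F2mats (t + d) n. real (card (H A))) * (sqrt \<tau> * \<mu> / D)\<^sup>2
      \<le> real (card (F2mats (t + d) n)) * real (card S)"
    using sum_heavy_cells[OF S(1), of "sqrt \<tau> * \<mu> / D" "t + d"] \<tau> \<mu>0 D0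
    by (simp add: H_def q_fiber)
  moreover have "(sqrt \<tau> * \<mu> / D)\<^sup>2 = \<tau> * \<mu>\<^sup>2 / D\<^sup>2"
    using \<tau> by (simp add: power_divide power_mult_distrib)
  ultimately have H_le: "(\<Sum>A\<in>F2mats (t + d) n. real (card (H A))) * (\<tau> * \<mu>\<^sup>2 / D\<^sup>2)
      \<le> real (card (F2mats (t + d) n)) * real (card S)" by simp
  have Ct: "real (card (F2mats (t + d) n)) = real (card (F2mats t n)) * real (card (F2mats d n))"
    by (simp add: card_F2mats power_add)
  have w0: "0 \<le> \<tau> * \<mu>\<^sup>2 / D\<^sup>2" using \<tau> by simp
  have "real (card Bad) * real (card (F2mats d n)) * (\<tau> * \<mu>\<^sup>2 / D\<^sup>2)
      \<le> 4 / 2 ^ (t + d) * (\<Sum>A\<in>F2mats (t + d) n. real (card (H A))) * (\<tau> * \<mu>\<^sup>2 / D\<^sup>2)"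
    using Bad_G G_H w0 by (intro mult_right_mono) auto
  also have "\<dots> \<le> 4 / 2 ^ (t + d) * (real (card (F2mats t n)) * real (card (F2mats d n)) * real (card S))"
    using H_le unfolding Ct mult.assoc by (intro mult_left_mono) auto
  also have "\<dots> = 4 * real (card (F2mats t n)) * (\<mu> / D) * real (card (F2mats d n))"
    by (simp add: \<mu> D_def power_add)
  finally have "real (card Bad) * (\<tau> * \<mu>\<^sup>2 / D\<^sup>2) * real (card (F2mats d n))
      \<le> 4 * real (card (F2mats t n)) * (\<mu> / D) * real (card (F2mats d n))"
    by (simp only: mult_ac)
  then have "real (card Bad) * (\<tau> * \<mu>\<^sup>2 / D\<^sup>2) \<le> 4 * real (card (F2mats t n)) * (\<mu> / D)"
    by (rule mult_right_le_imp_le) (use card_F2mats_pos[of d n] in simp)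
  then have "real (card Bad) * (\<tau> * \<mu>) * (\<mu> / D\<^sup>2) \<le> 4 * D * real (card (F2mats t n)) * (\<mu> / D\<^sup>2)"
    using D0 by (simp add: power2_eq_square mult_ac)
  then have "real (card Bad) * (\<tau> * \<mu>) \<le> 4 * D * real (card (F2mats t n))"
    using \<mu>0 D0 by (simp add: mult_le_cancel_right del: times_divide_eq_right)
  then show ?thesis by (simp add: Bad_def D_def)
qed

subsection \<open>Surjective maps\<close>

lemma F2surj_maps_subset: "F2surj_maps n t \<subseteq> F2mats t n"
  by (auto simp: F2surj_maps_def)

lemma finite_F2surj_maps [simp]: "finite (F2surj_maps n t)"
  using F2surj_maps_subset finite_F2mats finite_subset by blast

text \<open>The image of a non-surjective map misses at least half of the target, since it is disjoint
  from its translate by any point outside it.  So all these maps have large second moment.\<close>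

lemma card_F2mats_le_surj:
  assumes "t + 2 \<le> n"
  shows "card (F2mats t n) \<le> 2 * card (F2surj_maps n t)"
proof -
  let ?V = "F2vecs n" and ?m = "2 ^ n / 2 ^ t :: real"
  let ?N = "F2mats t n - F2surj_maps n t"
  \<comment> \<open>Each of the at least \<open>2^t / 2\<close> missed points has an empty fiber and
    contributes the full \<open>?m^2\<close>.\<close>
  have dev: "2 ^ t / 2 * ?m\<^sup>2 \<le> (\<Sum>y\<in>F2vecs t. (real (card (fiber A ?V y)) - ?m)\<^sup>2)"
    if A: "A \<in> ?N" for A
  proof -
    define I where "I = F2apply A ` ?V"
    have Am: "A \<in> F2mats t n" using A by simp
    have I: "I \<subseteq> F2vecs t" using F2apply_in_F2vecs[OF Am] by (auto simp: I_def)
    have "I \<noteq> F2vecs t" using A by (auto simp: F2surj_maps_def I_def)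
    then obtain z where z: "z \<in> F2vecs t" "z \<notin> I" using I by blast
    have closed: "F2add a b \<in> I" if ab: "a \<in> I" "b \<in> I" for a b
    proof -
      obtain x y where "x \<in> ?V" "y \<in> ?V" "a = F2apply A x" "b = F2apply A y"
        using ab by (auto simp: I_def)
      then show ?thesis
        unfolding I_def by (intro image_eqI[where x = "F2add x y"])
          (auto simp: F2apply_add[OF Am] F2add_in_F2vecs)
    qed
    have "card I \<le> card (F2vecs t - I)"
    proof (rule card_inj_on_le[where f = "F2add z"])
      show "inj_on (F2add z) I"
        using bij_betw_F2add[OF z(1)] I by (auto simp: bij_betw_def intro: inj_on_subset)
      show "F2add z ` I \<subseteq> F2vecs t - I"
      proof clarify
        fix a assume a: "a \<in> I"
        have la: "length z = length a" using a I z(1) by (auto simp: F2vecs_def)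
        have "F2add z a \<notin> I"
          using closed[of "F2add z a" a] a z(2) F2add_cancel_right[OF la] by auto
        then show "F2add z a \<in> F2vecs t - I" using a I z(1) F2add_in_F2vecs by blast
      qed
    qed simp
    moreover have "card I + card (F2vecs t - I) = 2 ^ t"
      using card_Diff_subset[of I "F2vecs t"] I card_mono[OF finite_F2vecs I]
        finite_subset[OF I] by simp
    ultimately have "2 ^ t \<le> 2 * card (F2vecs t - I)" by linarith
    then have "real (2 ^ t) \<le> real (2 * card (F2vecs t - I))" by (rule of_nat_mono)
    then have "2 ^ t / 2 * ?m\<^sup>2 \<le> real (card (F2vecs t - I)) * ?m\<^sup>2"
      by (intro mult_right_mono) auto
    also have "\<dots> = (\<Sum>y\<in>F2vecs t - I. (real (card (fiber A ?V y)) - ?m)\<^sup>2)"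
    proof -
      have "fiber A ?V y = {}" if "y \<in> F2vecs t - I" for y
        using that by (auto simp: fiber_def I_def)
      then show ?thesis by simp
    qed
    also have "\<dots> \<le> (\<Sum>y\<in>F2vecs t. (real (card (fiber A ?V y)) - ?m)\<^sup>2)"
      by (intro sum_mono2) auto
    finally show ?thesis .
  qed
  have "real (card ?N) * (2 ^ t / 2 * ?m\<^sup>2) = (\<Sum>A\<in>?N. 2 ^ t / 2 * ?m\<^sup>2)" by simp
  also have "\<dots> \<le> (\<Sum>A\<in>?N. \<Sum>y\<in>F2vecs t. (real (card (fiber A ?V y)) - ?m)\<^sup>2)"
    by (intro sum_mono dev)
  also have "\<dots> \<le> (\<Sum>A\<in>F2mats t n. \<Sum>y\<in>F2vecs t. (real (card (fiber A ?V y)) - ?m)\<^sup>2)"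
    by (intro sum_mono2) (auto intro: sum_nonneg)
  also have "\<dots> \<le> real (card (F2mats t n)) * 2 ^ n"
    using second_moment[of ?V n t] by simp
  finally have "real (card ?N) * 2 ^ n \<le> 2 * 2 ^ t * real (card (F2mats t n))"
    by (simp add: power2_eq_square field_simps)
  \<comment> \<open>The non-surjective fraction is at most \<open>2 * 2^t / 2^n\<close>; two spare
    dimensions bring it down to one half.\<close>
  moreover have "real (card ?N) * (2 ^ t * 4) \<le> real (card ?N) * 2 ^ n"
    using power_increasing[OF assms, of "2::real"] by (intro mult_left_mono) (auto simp: power_add)
  ultimately have "real (card ?N) * (2 ^ t * 4) \<le> 2 * 2 ^ t * real (card (F2mats t n))"
    by linarith
  then have "2 ^ t * real (2 * card ?N) \<le> 2 ^ t * real (card (F2mats t n))" by simp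
  then have "2 * card ?N \<le> card (F2mats t n)" by simp
  moreover have "card ?N = card (F2mats t n) - card (F2surj_maps n t)"
    by (intro card_Diff_subset F2surj_maps_subset finite_F2surj_maps)
  ultimately show ?thesis by linarith
qed

subsection \<open>The hashing theorem\<close>

text \<open>A probability differs from 1 by at most 1 and from 1/2 by at most 1/2. This settles
  \<open>n \<le> 1\<close>, where the condition \<open>t + 2 \<le> n\<close> of the general argument
  cannot hold.\<close>

lemma linf_close_uniform_trivial:
  assumes "t \<le> 1" "\<tau> > 1"
  shows "linf_close_uniform t (\<tau> / 2 ^ t) A S"
proof -
  have "\<bar>prob_image A S y - 1 / 2 ^ t\<bar> \<le> \<tau> / 2 ^ t" for y
  proof -
    \<comment> \<open>An infinite \<open>S\<close> has \<open>card S = 0\<close>, and the quotient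
      by 0 is then 0.\<close>
    have "card {x \<in> S. F2apply A x = y} \<le> card S \<or> card S = 0"
      by (cases "finite S") (auto intro: card_mono)
    then have "prob_image A S y \<le> 1" "0 \<le> prob_image A S y"
      by (auto simp: prob_image_def divide_le_eq_1)
    then have "\<bar>prob_image A S y - 1\<bar> \<le> \<tau>" "\<bar>prob_image A S y - 1 / 2\<bar> \<le> \<tau> / 2"
      using assms(2) by linarith+
    moreover have "t = 0 \<or> t = 1" using assms by linarith
    ultimately show ?thesis by auto
  qed
  then show ?thesis by (simp add: linf_close_uniform_def)
qed

text \<open>Without a surjective map the fraction of close maps would be \<open>0 / 0 = 0\<close>,
  so the small cases have to exhibit one.\<close>

lemma F2surj_maps_0_nonempty: "F2surj_maps n 0 \<noteq> {}"
proof -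
  have "replicate n False \<in> F2vecs n" by (simp add: F2vecs_def)
  then have "[] \<in> F2surj_maps n 0"
    by (auto simp: F2surj_maps_def F2mats_0 F2vecs_0 F2apply_def)
  then show ?thesis by blast
qed

lemma F2surj_maps_1_1_nonempty: "F2surj_maps 1 1 \<noteq> {}"
proof -
  have "F2apply [[True]] ` F2vecs 1 = F2vecs 1"
    by (force simp: F2vecs_Suc F2vecs_0 F2apply_def F2dot_Cons F2dot_Nil)
  then have "[[True]] \<in> F2surj_maps 1 1"
    by (simp add: F2surj_maps_def F2mats_def)
  then show ?thesis by blast
qed

text \<open>Supplies the number \<open>D\<close> of cells: at least \<open>n\<close>, to tame the
  constant \<open>2^(t/D)\<close>, and at most \<open>2 * n\<close>, to keep the cells large. The
  exponent grows only when \<open>n\<close> is itself \<open>2^d\<close>.\<close>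

lemma ex_power_two_between: "1 \<le> n \<Longrightarrow> \<exists>d. n \<le> 2 ^ d \<and> 2 ^ d \<le> 2 * n" for n :: nat
proof (induction n rule: nat_induct_at_least)
  case base
  then show ?case by (intro exI[of _ 0]) simp
next
  case (Suc n)
  then obtain d where d: "n \<le> 2 ^ d" "2 ^ d \<le> 2 * n" by blast
  show ?case
  proof (cases "n = 2 ^ d")
    case True
    then show ?thesis by (intro exI[of _ "Suc d"]) auto
  next
    case False
    then show ?thesis using d by (intro exI[of _ d]) auto
  qed
qed

text \<open>As \<open>\<tau> > 1\<close> and probabilities are nonnegative, only an overfull bucket
  can violate closeness. Surjective maps make up at least half of all matrices, so restricting to
  them at most doubles the bad fraction: hence 8 against the earlier 4.\<close>

lemma close_fraction_ge:
  assumes S: "S \<subseteq> F2vecs n" "S \<noteq> {}" and \<tau>: "\<tau> > 1" and t: "t \<le> 2 ^ d" "t + 2 \<le> n"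
    and \<mu>: "\<mu> = real (card S) / 2 ^ t"
    and large: "2 * (2 ^ d)\<^sup>2 * (1 + \<tau>) \<le> (\<tau> - sqrt \<tau>)\<^sup>2 * \<mu>" "8 * 2 ^ d \<le> \<delta> * (\<tau> * \<mu>)"
  shows "real (card {A \<in> F2surj_maps n t. linf_close_uniform t (\<tau> / 2 ^ t) A S})
    / real (card (F2surj_maps n t)) \<ge> 1 - \<delta>"
proof -
  let ?Good = "{A \<in> F2surj_maps n t. linf_close_uniform t (\<tau> / 2 ^ t) A S}"
  let ?Bad = "{L \<in> F2mats t n. \<exists>y\<in>F2vecs t. (1 + \<tau>) * \<mu> < real (card (fiber L S y))}"
  have S0: "real (card S) > 0"
    using S finite_subset[OF S(1)] by (simp add: card_gt_0_iff)
  have \<mu>0: "\<mu> > 0" using S0 \<mu> by simp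
  have \<delta>0: "0 < \<delta>"
  proof -
    have "(0::real) < 8 * 2 ^ d" by simp
    then have "0 < \<delta> * (\<tau> * \<mu>)" using large(2) by linarith
    moreover have "0 < \<tau> * \<mu>" using \<tau> \<mu>0 by simp
    ultimately show ?thesis by (rule zero_less_mult_pos2)
  qed
  have "F2surj_maps n t - ?Good \<subseteq> ?Bad"
  proof
    fix A assume A: "A \<in> F2surj_maps n t - ?Good"
    then obtain y where y: "y \<in> F2vecs t" "\<tau> / 2 ^ t < \<bar>prob_image A S y - 1 / 2 ^ t\<bar>"
      by (auto simp: linf_close_uniform_def not_le)
    have "1 / 2 ^ t < \<tau> / 2 ^ t" using \<tau> by (intro divide_strict_right_mono) auto
    moreover have "0 \<le> prob_image A S y" by (simp add: prob_image_def)
    ultimately have "1 / 2 ^ t + \<tau> / 2 ^ t < prob_image A S y" using y(2) by linarith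
    then have "(1 + \<tau>) * \<mu> < real (card (fiber A S y))"
      using S0 by (simp add: prob_image_def fiber_def \<mu> field_simps)
    then show "A \<in> ?Bad" using A y(1) F2surj_maps_subset by blast
  qed
  then have "card (F2surj_maps n t - ?Good) \<le> card ?Bad" by (intro card_mono) auto
  moreover have "card (F2surj_maps n t - ?Good) = card (F2surj_maps n t) - card ?Good"
    by (rule card_Diff_subset) auto
  ultimately have good: "real (card (F2surj_maps n t)) \<le> real (card ?Good) + real (card ?Bad)"
    by linarith
  have "real (card ?Bad) * (8 * 2 ^ d) \<le> real (card ?Bad) * (\<delta> * (\<tau> * \<mu>))"
    using large(2) by (intro mult_left_mono) auto
  also have "\<dots> = \<delta> * (real (card ?Bad) * (\<tau> * \<mu>))" by simp
  also have "\<dots> \<le> \<delta> * (4 * 2 ^ d * real (card (F2mats t n)))"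
    using \<delta>0 by (intro mult_left_mono card_maps_with_large_bucket[OF S \<tau> t(1) \<mu> large(1)]) auto
  finally have bad: "2 * real (card ?Bad) \<le> \<delta> * real (card (F2mats t n))" by simp
  have surj: "card (F2mats t n) \<le> 2 * card (F2surj_maps n t)"
    by (rule card_F2mats_le_surj[OF t(2)])
  then have "real (card (F2mats t n)) \<le> 2 * real (card (F2surj_maps n t))" by linarith
  then have "\<delta> * real (card (F2mats t n)) \<le> \<delta> * (2 * real (card (F2surj_maps n t)))"
    using \<delta>0 by (intro mult_left_mono) auto
  then have "(1 - \<delta>) * real (card (F2surj_maps n t)) \<le> real (card ?Good)"
    using good bad by (simp add: algebra_simps)
  moreover have "card (F2surj_maps n t) > 0" using surj card_F2mats_pos[of t n] by linarith
  ultimately show ?thesis by (simp add: pos_le_divide_eq)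
qed

section \<open>Choice of parameters, with \<open>n \<le> 1\<close> treated apart\<close>

theorem mainTheorem6:
  fixes S :: "bool list set" and n :: nat and \<delta> \<tau> :: real
  assumes "S \<subseteq> F2vecs n"
    and "0 < \<delta>" and "\<delta> \<le> 1/10"
    and "\<tau> > 1"
    and "real (card S) > max ((real n)^4 * (1+\<tau>)^4 / ((\<tau> - sqrt \<tau>) * \<delta>)^8) ((real n)^4)"
    and "real n \<ge> 20 * real_of_int \<lceil>log 2 (max (real n * (1+\<tau>) / ((\<tau> - sqrt \<tau>) * \<delta>)^2) (real n))\<rceil>"
  shows "\<exists>t::nat. real t \<ge> log 2 (real (card S))
              - 4 * log 2 (max (real n * (1+\<tau>) / ((\<tau> - sqrt \<tau>)^2 * \<delta>^2)) (real n))
          \<and> real (card {A \<in> F2surj_maps n t. linf_close_uniform t (\<tau> / 2 ^ t) A S})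
              / real (card (F2surj_maps n t)) \<ge> 1 - \<delta>"
proof -
  let ?close = "\<lambda>t. {A \<in> F2surj_maps n t. linf_close_uniform t (\<tau> / 2 ^ t) A S}"
  define g where "g = \<tau> - sqrt \<tau>"
  define M where "M = max (real n * (1 + \<tau>) / (g\<^sup>2 * \<delta>\<^sup>2)) (real n)"
  have g0: "g > 0" using assms(4) by (simp add: g_def real_less_lsqrt power2_eq_square)
  have M_alt: "M = max (real n * (1 + \<tau>) / ((\<tau> - sqrt \<tau>) * \<delta>)^2) (real n)"
    by (simp add: M_def g_def power_mult_distrib)
  have M_n: "real n \<le> M" by (simp add: M_def)
  have S_le: "card S \<le> 2 ^ n" using card_mono[OF finite_F2vecs assms(1)] by simp
  have trivial: ?thesis if t: "t \<le> 1" "F2surj_maps n t \<noteq> {}"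
    "real t \<ge> log 2 (real (card S)) - 4 * log 2 M" for t
  proof -
    have "?close t = F2surj_maps n t"
      using linf_close_uniform_trivial[OF t(1) assms(4)] by auto
    moreover have "card (F2surj_maps n t) \<noteq> 0" using t(2) by simp
    ultimately have "real (card (?close t)) / real (card (F2surj_maps n t)) = 1" by simp
    then show ?thesis
      using t(3) assms(2) unfolding M_def g_def by (intro exI[of _ t] conjI) linarith+
  qed
  have S0: "card S > 0"
  proof -
    have "0 \<le> (real n)^4" "(real n)^4 < real (card S)" using assms(5) by auto
    then show ?thesis by linarith
  qed
  consider "n = 0" | "n = 1" | "n \<ge> 2" by linarith
  then show ?thesis
  proof cases
    case 1
    then have "card S = 1" using S_le S0 by simp
    \<comment> \<open>\<open>M\<close> is 0 here, and \<open>log 2 0\<close> is 0 by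
      convention.\<close>
    moreover have "log 2 M = 0" using 1 by (simp add: M_def log_def)
    ultimately show ?thesis using trivial[of 0] F2surj_maps_0_nonempty by simp
  next
    case 2
    have "log 2 (real (card S)) \<le> log 2 2" using S_le S0 2 by (intro log_mono) auto
    moreover have "log 2 M \<ge> 0" using M_n 2 by (intro zero_le_log_cancel_iff[THEN iffD2]) auto
    ultimately show ?thesis using 2 trivial[of 1] F2surj_maps_1_1_nonempty by simp
  next
    case 3
    \<comment> \<open>\<open>M \<ge> 2\<close> makes the ceiling at least 1, so that
      \<open>n \<ge> 20\<close>; this feeds the numerical slack below.\<close>
    have "1 \<le> log 2 M" using M_n 3 by (simp add: le_log_iff)
    then have "1 \<le> \<lceil>log 2 M\<rceil>" by linarith
    then have n20: "real n \<ge> 20" using assms(6) unfolding M_alt[symmetric] by linarith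
    have M20: "M \<ge> 20" using M_n n20 by linarith
    have M_pow: "M ^ 4 < real (card S)"
    proof (cases "M = real n")
      case True
      then show ?thesis using assms(5) by simp
    next
      case False
      then have "M = real n * (1 + \<tau>) / ((\<tau> - sqrt \<tau>) * \<delta>)^2" by (auto simp: M_alt max_def)
      then have "M ^ 4 = (real n)^4 * (1+\<tau>)^4 / ((\<tau> - sqrt \<tau>) * \<delta>)^8"
        by (simp add: power_divide power_mult_distrib flip: power_mult)
      then show ?thesis using assms(5) by simp
    qed
    define x where "x = log 2 (real (card S)) - 4 * log 2 M"
    \<comment> \<open>The least admissible \<open>t\<close>; as \<open>x > 0\<close>,
      \<open>nat\<close> truncates nothing. Rounding up costs a factor below 2, so
      \<open>\<mu>\<close> is still at least \<open>M^4 / 2\<close>.\<close>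
    define t where "t = nat \<lceil>x\<rceil>"
    have x_log: "x = log 2 (real (card S) / M ^ 4)"
      using S0 M20 by (simp add: x_def log_divide log_nat_power)
    have M4: "M ^ 4 > 0" using M20 by simp
    then have "1 < real (card S) / M ^ 4" using M_pow by (simp add: less_divide_eq_1)
    then have x0: "x > 0" by (simp add: x_log)
    then have tx: "x \<le> real t" "real t < x + 1" unfolding t_def by linarith+
    have "2 powr x = real (card S) / M ^ 4"
      using S0 M20 by (simp add: x_log)
    moreover have "2 powr real t < 2 powr (x + 1)" using tx by simp
    ultimately have t_less: "2 ^ t < 2 * (real (card S) / M ^ 4)"
      by (simp add: powr_realpow powr_add mult.commute)
    define \<mu> where "\<mu> = real (card S) / 2 ^ t"
    have \<mu>_M: "M ^ 4 / 2 \<le> \<mu>"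
      using t_less M4 by (simp add: \<mu>_def field_simps)
    have M3: "20 * (real n)\<^sup>2 \<le> M ^ 3"
    proof -
      have "20 * (real n)\<^sup>2 \<le> M * M\<^sup>2" using M20 M_n by (intro mult_mono power_mono) auto
      then show ?thesis by (simp add: power3_eq_cube power2_eq_square)
    qed
    \<comment> \<open>One factor \<open>M\<close> is kept to absorb \<open>\<tau>\<close> and
      \<open>\<delta>\<close>; the other three pay for powers of \<open>n\<close>.\<close>
    have \<mu>_n: "M * (10 * (real n)\<^sup>2) \<le> \<mu>"
    proof -
      have "M * (20 * (real n)\<^sup>2) \<le> M * M ^ 3" using M3 M20 by (intro mult_left_mono) auto
      also have "M * M ^ 3 = M ^ 4" by (simp add: power_numeral_reduce)
      finally show ?thesis using \<mu>_M by simp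
    qed
    have t_n: "t + 2 \<le> n"
    proof -
      have S_le': "real (card S) \<le> 2 ^ n" using of_nat_mono[OF S_le, where 'a = real] by simp
      have "(8::real) \<le> 20 ^ 4" by simp
      also have "\<dots> \<le> M ^ 4" using M20 by (intro power_mono) auto
      finally have "2 ^ t * 8 \<le> 2 ^ t * M ^ 4" by simp
      also have "\<dots> < 2 * real (card S)" using t_less M4 by (simp add: field_simps)
      also have "\<dots> \<le> 2 * 2 ^ n" using S_le' by simp
      finally have "(2::real) ^ (t + 2) < 2 ^ n" by (simp add: power_add)
      then have "t + 2 < n" by (rule power_less_imp_less_exp[rotated]) simp
      then show ?thesis by simp
    qed
    obtain d where d: "n \<le> 2 ^ d" "2 ^ d \<le> 2 * n"
      using ex_power_two_between[of n] 3 by auto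
    have "real (2 ^ d) \<le> real (2 * n)" using d(2) by (rule of_nat_mono)
    then have d': "2 ^ d \<le> 2 * real n" by simp
    have M_g: "real n * (1 + \<tau>) \<le> g\<^sup>2 * \<delta>\<^sup>2 * M"
    proof -
      have "real n * (1 + \<tau>) / (g\<^sup>2 * \<delta>\<^sup>2) \<le> M" by (simp add: M_def)
      then show ?thesis using g0 assms(2) by (simp add: pos_divide_le_eq mult_ac)
    qed
    have \<delta>2: "\<delta>\<^sup>2 \<le> 1" "\<delta>\<^sup>2 \<le> \<delta>"
      using assms(2,3) by (auto simp: power2_eq_square mult_le_one mult_left_le)
    show ?thesis
    proof (intro exI[of _ t] conjI)
      show "log 2 (real (card S)) - 4 * log 2 (max (real n * (1+\<tau>) / ((\<tau> - sqrt \<tau>)^2 * \<delta>^2)) (real n))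
        \<le> real t" using tx(1) by (simp add: x_def M_def g_def)
      show "1 - \<delta> \<le> real (card (?close t)) / real (card (F2surj_maps n t))"
      proof (rule close_fraction_ge[OF assms(1) _ assms(4) _ t_n \<mu>_def])
        show "S \<noteq> {}" using S0 by auto
        show "t \<le> 2 ^ d" using t_n d by linarith
        have "2 * (2 ^ d)\<^sup>2 * (1 + \<tau>) \<le> 2 * (2 * real n)\<^sup>2 * (1 + \<tau>)"
          using d' assms(4) by (intro mult_right_mono mult_left_mono power_mono) auto
        also have "\<dots> = 8 * real n * (real n * (1 + \<tau>))" by (simp add: power2_eq_square)
        also have "\<dots> \<le> 8 * real n * (g\<^sup>2 * M)"
        proof -
          have "g\<^sup>2 * \<delta>\<^sup>2 * M \<le> g\<^sup>2 * 1 * M"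
            using \<delta>2 M20 by (intro mult_right_mono mult_left_mono) auto
          then show ?thesis using M_g by (intro mult_left_mono) auto
        qed
        also have "\<dots> = g\<^sup>2 * (M * (8 * real n))" by simp
        also have "\<dots> \<le> g\<^sup>2 * \<mu>"
        proof -
          have "8 * real n \<le> 10 * (real n)\<^sup>2" using n20 by (simp add: power2_eq_square)
          then have "M * (8 * real n) \<le> M * (10 * (real n)\<^sup>2)"
            using M20 by (intro mult_left_mono) auto
          then show ?thesis using \<mu>_n by (intro mult_left_mono) auto
        qed
        finally show "2 * (2 ^ d)\<^sup>2 * (1 + \<tau>) \<le> (\<tau> - sqrt \<tau>)\<^sup>2 * \<mu>" by (simp add: g_def)
        \<comment> \<open>\<open>g^2 * \<delta>^2\<close> is bounded by
          \<open>\<tau>^2 * \<delta>\<close>, and one \<open>\<tau>\<close> cancels against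
          \<open>1 + \<tau> \<ge> \<tau>\<close>.\<close>
        have "real n \<le> \<delta> * \<tau> * M"
        proof -
          have "g \<le> \<tau>" using assms(4) by (simp add: g_def)
          then have "g\<^sup>2 \<le> \<tau> * \<tau>" using g0 by (simp add: power2_eq_square mult_mono)
          then have "g\<^sup>2 * \<delta>\<^sup>2 \<le> (\<tau> * \<tau>) * \<delta>"
            using \<delta>2 assms(4) by (intro mult_mono) auto
          then have "g\<^sup>2 * \<delta>\<^sup>2 * M \<le> (\<tau> * \<tau>) * \<delta> * M" using M20 by (intro mult_right_mono) auto
          then have "real n * (1 + \<tau>) \<le> \<tau> * (\<delta> * \<tau> * M)" using M_g by (simp add: mult_ac)
          moreover have "\<tau> * real n \<le> real n * (1 + \<tau>)" by (simp add: algebra_simps)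
          ultimately have "\<tau> * real n \<le> \<tau> * (\<delta> * \<tau> * M)" by linarith
          then show ?thesis using assms(4) by simp
        qed
        then have "real n * (10 * (real n)\<^sup>2) \<le> \<delta> * \<tau> * M * (10 * (real n)\<^sup>2)"
          by (intro mult_right_mono) auto
        also have "\<dots> \<le> \<delta> * \<tau> * \<mu>"
          unfolding mult.assoc[of "\<delta> * \<tau>"] using \<mu>_n assms(2,4) by (intro mult_left_mono) auto
        finally have "real n * (10 * (real n)\<^sup>2) \<le> \<delta> * (\<tau> * \<mu>)" by (simp add: mult.assoc)
        \<comment> \<open>\<open>8 * 2^d\<close> is at most \<open>16 * n\<close>, so
          \<open>20 * n\<close> is enough.\<close>
        moreover have "real n * 20 \<le> real n * (10 * (real n)\<^sup>2)"
        proof (rule mult_left_mono)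
          have "20 * 20 \<le> real n * real n" using n20 by (intro mult_mono) auto
          then show "20 \<le> 10 * (real n)\<^sup>2" by (simp add: power2_eq_square)
        qed simp
        ultimately show "8 * 2 ^ d \<le> \<delta> * (\<tau> * \<mu>)" using d' by linarith
      qed
    qed
  qed
qed

end
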